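(* Let $\alpha,\beta\in\mathbb{C}$ satisfy $\operatorname{Re}(\alpha)>0$, $\operatorname{Re}(\beta)>0$ and $\alpha\beta=4\pi^2$, and let $x,y>0$ be real. Then for every positive integer $N$, $$ \begin{aligned} &\sum_{k=1}^{N} (-\alpha)^{N+1-k}\beta^{k}\,\zeta_E(2k,x)\,\zeta_E(2(N+1-k),y)\\ &=\beta^{N+1}\,\frac{1}{2}\,i\sqrt{\frac{\alpha}{\beta}}\sum_{n=0}^{\infty}\frac{(-1)^n}{(n+x)^{2N+1}}\left[\widetilde{\psi}\!\left(y+i\sqrt{\frac{\alpha}{\beta}}\,(n+x)\right)-\widetilde{\psi}\!\left(y-i\sqrt{\frac{\alpha}{\beta}}\,(n+x)\right)\right]\\ &\quad+(-\alpha)^{N+1}\,\frac{1}{2}\,i\sqrt{\frac{\beta}{\alpha}}\sum_{n=0}^{\infty}\frac{(-1)^n}{(n+y)^{2N+1}}\left[\widetilde{\psi}\!\left(x+i\sqrt{\frac{\beta}{\alpha}}\,(n+y)\right)-\widetilde{\psi}\!\left(x-i\sqrt{\frac{\beta}{\alpha}}\,(n+y)\right)\right]. \end{aligned} $$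
   Context: The alternating Hurwitz zeta function is $\zeta_E(z,x)=\sum_{n=0}^{\infty}\frac{(-1)^n}{(n+x)^z}$ for $\operatorname{Re}(z)>0$, $x\neq 0,-1,-2,\dots$. The alternating digamma function is $\widetilde{\psi}(w)=-\zeta_E(1,w)=-\sum_{n=0}^{\infty}\frac{(-1)^n}{n+w}$ for complex $w\notin\{0,-1,-2,\dots\}$. Square roots are principal branches, so that $\sqrt{\alpha/\beta}=\alpha/(2\pi)$ and $\sqrt{\beta/\alpha}=\beta/(2\pi)$. *)

theory Defs
  imports "HOL-Analysis.Analysis"
begin

text \<open>
  The intended domain is \<open>Re z > 0\<close> and \<open>x \<noteq> 0, -1, -2, \<dots>\<close>. For \<open>0 < Re z \<le> 1\<close> the series
  converges only conditionally, hence the sequential sum. Complex powers are principal.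
\<close>

definition alt_hurwitz_zeta :: "complex \<Rightarrow> complex \<Rightarrow> complex" where
  "alt_hurwitz_zeta z x = (\<Sum>n. (-1) ^ n / (of_nat n + x) powr z)"

definition alt_digamma :: "complex \<Rightarrow> complex" where
  "alt_digamma w = - alt_hurwitz_zeta 1 w"

end

theory Submission
  imports Defs
begin

text \<open>
  Put \<open>c = \<alpha> / 2\<pi>\<close>, \<open>a = n + x\<close>, \<open>b = m + y\<close>. The digamma difference at \<open>y \<plusminus> i c a\<close> is
  \<open>2 i c a \<Sum>\<^sub>m (-1)^m / (b^2 + c^2 a^2)\<close>, so all three series are double sums over \<open>(n, m)\<close>.
  They converge absolutely because \<open>Re c > 0\<close> gives \<open>\<bar>b^2 + c^2 a^2\<bar> \<ge> \<delta> b^2\<close>, and termwise the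
  identity is the finite geometric sum \<open>\<Sum>\<^sub>k u^k v^(N+1-k)\<close> for \<open>u = \<beta> / a^2\<close>, \<open>v = -\<alpha> / b^2\<close>.
\<close>

section \<open>Absolutely convergent double series as unordered sums over pairs\<close>

lemma summable_inverse_shift_power:
  fixes x :: real
  assumes "x > 0" and "k \<ge> 2"
  shows "summable (\<lambda>n. 1 / (real n + x) ^ k)"
proof (rule summable_comparison_test')
  show "summable (\<lambda>n. inverse (real n ^ k))"
    using inverse_power_summable[OF assms(2), where 'a = real] by simp
  fix n :: nat assume "n \<ge> 1"
  then have "real n ^ k \<le> (real n + x) ^ k" "real n ^ k > 0"
    using assms(1) by (auto intro!: power_mono)
  then show "norm (1 / (real n + x) ^ k) \<le> inverse (real n ^ k)"
    using assms(1) by (simp add: field_simps)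
qed

lemma norm_of_nat_plus_of_real:
  assumes "x > 0"
  shows "norm (of_nat n + of_real x :: complex) = real n + x"
proof -
  have "(of_nat n + of_real x :: complex) = of_real (real n + x)" by simp
  then show ?thesis using assms by (simp only: norm_of_real)
qed

text \<open>Domination by a product of summable sequences gives absolute summability over pairs, so
  Fubini applies. In the unordered sum the two digamma series, whose iterated sums run in opposite
  orders, become comparable.\<close>

lemma iterated_suminf_eq_infsum:
  fixes f :: "nat \<times> nat \<Rightarrow> 'a :: banach"
  assumes "summable p" and "summable q"
    and "\<And>n. p n \<ge> (0::real)" and "\<And>m. q m \<ge> 0"
    and bound: "\<And>n m. norm (f (n, m)) \<le> p n * q m"
  shows "f summable_on UNIV"
    and "(\<Sum>n. \<Sum>m. f (n, m)) = infsum f UNIV"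
proof -
  have q: "((\<lambda>m. p n * q m) has_sum p n * suminf q) UNIV" for n
    using assms by (intro has_sum_cmult_right norm_summable_imp_has_sum) (auto intro: summable_sums)
  have p: "(\<lambda>n. p n * suminf q) summable_on UNIV"
    using assms by (intro summable_on_cmult_left norm_summable_imp_summable_on) auto
  have "(\<lambda>(n, m). p n * q m) summable_on UNIV \<times> UNIV"
    using q p assms by (intro summable_on_SigmaI[where g = "\<lambda>n. p n * suminf q"]) auto
  then have "f abs_summable_on UNIV \<times> UNIV"
    by (rule Infinite_Sum.abs_summable_on_comparison_test') (use bound in auto)
  then have s: "f summable_on UNIV \<times> UNIV"
    by (rule abs_summable_summable)
  then show "f summable_on UNIV" by simp
  have "(\<lambda>m. f (n, m)) summable_on UNIV" for n
  proof (rule norm_summable_imp_summable_on, rule summable_comparison_test')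
    show "summable (\<lambda>m. p n * q m)" using assms by (intro summable_mult)
  qed (use bound in auto)
  then have inner: "(\<Sum>m. f (n, m)) = infsum (\<lambda>m. f (n, m)) UNIV" for n
    by (metis has_sum_imp_sums has_sum_infsum sums_unique)
  have "(\<lambda>n. infsum (\<lambda>m. f (n, m)) UNIV) summable_on UNIV"
    using s by (intro summable_on_Sigma_banach[where f = "\<lambda>n m. f (n, m)"]) (simp add: case_prod_beta)
  then have "(\<Sum>n. infsum (\<lambda>m. f (n, m)) UNIV) = infsum (\<lambda>n. infsum (\<lambda>m. f (n, m)) UNIV) UNIV"
    by (metis has_sum_imp_sums has_sum_infsum sums_unique)
  also have "\<dots> = infsum f (UNIV \<times> UNIV)"
    using s by (rule infsum_Sigma_banach)
  finally show "(\<Sum>n. \<Sum>m. f (n, m)) = infsum f UNIV" by (simp add: inner)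
qed

lemma has_sum_sum:
  fixes f :: "'i \<Rightarrow> 'a \<Rightarrow> 'b :: topological_comm_monoid_add"
  assumes "\<And>i. i \<in> I \<Longrightarrow> (f i has_sum s i) A"
  shows "((\<lambda>x. \<Sum>i\<in>I. f i x) has_sum (\<Sum>i\<in>I. s i)) A"
  using assms by (induction I rule: infinite_finite_induct) (auto intro!: has_sum_add)

text \<open>The dominating product is exact here: the norm of a term is
  \<open>norm (f n) * norm (g m)\<close>. This puts each product of two zeta values on the same
  index set as the digamma series.\<close>

lemma suminf_mult_suminf_eq_infsum:
  fixes f g :: "nat \<Rightarrow> 'a :: {banach, real_normed_field}"
  assumes f: "summable (\<lambda>n. norm (f n))" and g: "summable (\<lambda>n. norm (g n))"
  shows "(\<lambda>(n, m). f n * g m) summable_on UNIV"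
    and "suminf f * suminf g = (\<Sum>\<^sub>\<infinity>(n, m). f n * g m)"
proof -
  have *: "norm ((\<lambda>(n, m). f n * g m) (n, m)) \<le> norm (f n) * norm (g m)" for n m
    by (simp add: norm_mult)
  show "(\<lambda>(n, m). f n * g m) summable_on UNIV"
    using iterated_suminf_eq_infsum(1)[OF f g _ _ *] by simp
  have "suminf f * suminf g = (\<Sum>n. \<Sum>m. f n * g m)"
    using f g by (simp add: suminf_mult2 suminf_mult summable_norm_cancel)
  also have "\<dots> = (\<Sum>\<^sub>\<infinity>(n, m). f n * g m)"
    using iterated_suminf_eq_infsum(2)[OF f g _ _ *] by simp
  finally show "suminf f * suminf g = (\<Sum>\<^sub>\<infinity>(n, m). f n * g m)" .
qed

section \<open>Series for the alternating zeta and digamma functions\<close>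

lemma alt_hurwitz_zeta_of_nat:
  assumes "k > 0"
  shows "alt_hurwitz_zeta (of_nat k) w = (\<Sum>n. (-1) ^ n / (of_nat n + w) ^ k)"
  \<comment> \<open>For positive \<open>k\<close> the principal and the natural power agree even at
    base 0; at exponent 0 they would be 0 and 1 there.\<close>
  using assms by (simp add: alt_hurwitz_zeta_def powr_nat')

lemma alt_digamma_eq: "alt_digamma w = - (\<Sum>n. (-1) ^ n / (of_nat n + w))"
  using alt_hurwitz_zeta_of_nat[of 1 w] by (simp add: alt_digamma_def)

text \<open>Convergence is only conditional, so the series is compared with the alternating harmonic
  series: that one converges by Leibniz, and the termwise difference is O(1/n^2). A nonreal
  \<open>w\<close> keeps all denominators nonzero.\<close>

lemma summable_alt_digamma:
  fixes w :: complex
  assumes "Im w \<noteq> 0"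
  shows "summable (\<lambda>n. (-1) ^ n / (of_nat n + w))"
proof -
  have leibniz: "summable (\<lambda>n. (-1) ^ n * inverse (real (Suc n)))"
    by (rule summable_Leibniz(1)[OF LIMSEQ_inverse_real_of_nat])
       (auto simp: monoseq_def field_simps)
  have A: "summable (\<lambda>n. (-1) ^ n / of_nat (Suc n) :: complex)"
    using summable_of_real[OF leibniz, where 'a = complex]
    by (simp add: divide_inverse)
  \<comment> \<open>From \<open>M\<close> on, \<open>norm w\<close> is at most n/2, hence
    \<open>norm (of_nat n + w)\<close> is at least n/2; the added 1 keeps \<open>n\<close>
    positive.\<close>
  define M where "M = nat \<lceil>2 * norm w\<rceil> + 1"
  have nz: "of_nat n + w \<noteq> 0" for n
    using assms by (auto simp: complex_eq_iff)
  have B: "summable (\<lambda>n. (-1) ^ n / (of_nat n + w) - (-1) ^ n / of_nat (Suc n) :: complex)"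
  proof (rule summable_comparison_test')
    show "summable (\<lambda>n. 2 * norm (1 - w) * inverse (real n ^ 2))"
      using inverse_power_summable[of 2, where 'a = real] by (intro summable_mult) auto
    fix n assume "n \<ge> M"
    then have n: "real n \<ge> 2 * norm w" "real n \<ge> 1" unfolding M_def by linarith+
    have "norm (of_nat n :: complex) - norm w \<le> norm (of_nat n + w)"
      by (metis norm_diff_ineq)
    then have "real n / 2 \<le> norm (of_nat n + w)" using n by simp
    then have le: "real n / 2 * real n \<le> norm (of_nat n + w) * real (Suc n)"
      using n by (intro mult_mono) auto
    have "(-1) ^ n / (of_nat n + w) - (-1) ^ n / of_nat (Suc n) =
        (-1) ^ n * (1 - w) / ((of_nat n + w) * of_nat (Suc n))"
      using nz[of n] of_nat_neq_0[of n, where 'a = complex]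
      by (simp add: divide_simps del: of_nat_Suc) (simp add: algebra_simps)
    then have "norm ((-1) ^ n / (of_nat n + w) - (-1) ^ n / of_nat (Suc n)) =
        norm (1 - w) / (norm (of_nat n + w) * real (Suc n))"
      by (simp only: norm_divide norm_mult norm_power norm_of_nat) simp
    also have "\<dots> \<le> norm (1 - w) / (real n / 2 * real n)"
      using n le by (intro divide_left_mono) (auto intro!: mult_pos_pos simp: nz)
    finally show "norm ((-1) ^ n / (of_nat n + w) - (-1) ^ n / of_nat (Suc n))
        \<le> 2 * norm (1 - w) * inverse (real n ^ 2)"
      using n by (simp add: field_simps power2_eq_square)
  qed
  show ?thesis using summable_add[OF A B] by simp
qed

text \<open>Partial fractions: 1/(m+w-z) - 1/(m+w+z) = 2z / ((m+w)^2 - z^2). Both series converge,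
  so they may be subtracted term by term; z = 0 is split off because the proof divides by
  2z.\<close>

lemma alt_digamma_diff:
  fixes w z :: complex
  assumes "Im (w + z) \<noteq> 0" and "Im (w - z) \<noteq> 0"
  shows "alt_digamma (w + z) - alt_digamma (w - z) =
           2 * z * (\<Sum>m. (-1) ^ m / ((of_nat m + w)\<^sup>2 - z\<^sup>2))"
proof (cases "z = 0")
  case False
  define f where "f = (\<lambda>m. (-1) ^ m / (of_nat m + (w - z)) - (-1) ^ m / (of_nat m + (w + z)))"
  have s: "summable f"
    unfolding f_def using assms by (intro summable_diff summable_alt_digamma)
  have "of_nat m + (w + z) \<noteq> 0" "of_nat m + (w - z) \<noteq> 0" for m
    using assms by (auto simp: complex_eq_iff)
  moreover have "(of_nat m + w)\<^sup>2 - z\<^sup>2 = (of_nat m + (w + z)) * (of_nat m + (w - z))" for m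
    by (simp add: power2_eq_square algebra_simps)
  ultimately have f: "(-1) ^ m / ((of_nat m + w)\<^sup>2 - z\<^sup>2) = f m / (2 * z)" for m
    using False unfolding f_def by (simp add: divide_simps) (simp add: algebra_simps)
  have "alt_digamma (w + z) - alt_digamma (w - z) = suminf f"
    unfolding f_def alt_digamma_eq using assms
    by (subst suminf_diff[symmetric]) (auto intro: summable_alt_digamma)
  then show ?thesis
    unfolding f using False s by (simp add: suminf_divide)
qed auto

section \<open>The digamma sums as double series\<close>

lemma norm_sum_squares_ge:
  fixes c :: complex and a b :: real
  assumes "Re c > 0" and "b \<ge> 0"
  shows "norm (of_real b ^ 2 + c ^ 2 * of_real a ^ 2) \<ge> (Re c / norm c) ^ 2 * b ^ 2"
proof -
  have c: "norm c > 0" using assms(1) by auto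
  \<comment> \<open>Multiplying by \<open>cnj c\<close> makes the second summand purely imaginary,
    so the real part of the product is \<open>b * Re c\<close> whatever \<open>t\<close> is. The
    values t = a and t = -a then bound the two factors of b^2 + c^2 a^2.\<close>
  have *: "b * (Re c / norm c) \<le> norm (of_real b + \<i> * c * of_real t)" for t
  proof -
    have "b * Re c = Re ((of_real b + \<i> * c * of_real t) * cnj c)"
      by (simp add: algebra_simps)
    also have "\<dots> \<le> norm (of_real b + \<i> * c * of_real t) * norm c"
      by (metis complex_Re_le_cmod complex_mod_cnj norm_mult)
    finally show ?thesis using c by (simp add: field_simps)
  qed
  have "(b * (Re c / norm c)) * (b * (Re c / norm c)) \<le>
      norm (of_real b + \<i> * c * of_real a) * norm (of_real b + \<i> * c * of_real (- a))"
    using assms c by (intro mult_mono *) auto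
  also have "\<dots> = norm (of_real b ^ 2 + c ^ 2 * of_real a ^ 2)"
    unfolding norm_mult[symmetric] by (simp add: algebra_simps power2_eq_square)
  finally show ?thesis by (simp add: power2_eq_square algebra_simps)
qed

text \<open>The difference formula at w = y, z = \<open>\<i> * c * a\<close> with a = n + x has a
  prefactor 2z, whose \<open>a\<close> cancels one power of the outer denominator and leaves a^(2N).
  The remaining power gives decay in \<open>n\<close>, and the lower bound on the sum of squares
  gives decay in \<open>m\<close> uniformly in \<open>n\<close>.\<close>

lemma alt_digamma_series:
  fixes c :: complex and x y :: real and N :: nat
  assumes c: "Re c > 0" and x: "x > 0" and y: "y > 0" and N: "N > 0"
  defines "K \<equiv> (\<lambda>(n, m). (-1) ^ n * (-1) ^ m / ((of_nat n + of_real x) ^ (2 * N) *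
      ((of_nat m + of_real y) ^ 2 + c ^ 2 * (of_nat n + of_real x) ^ 2)) :: complex)"
  shows "K summable_on UNIV"
    and "(\<Sum>n. (-1) ^ n / (of_nat n + of_real x) ^ (2 * N + 1) *
            (alt_digamma (of_real y + \<i> * c * (of_nat n + of_real x)) -
             alt_digamma (of_real y - \<i> * c * (of_nat n + of_real x)))) =
         2 * \<i> * c * infsum K UNIV"
proof -
  define d where "d = (Re c / norm c) ^ 2"
  have "c \<noteq> 0" using c by auto
  then have d: "d > 0" using c unfolding d_def by simp
  define p where "p = (\<lambda>n. 1 / (real n + x) ^ (2 * N))"
  define q where "q = (\<lambda>m. 1 / (real m + y) ^ 2 / d)"
  have p: "summable p" unfolding p_def
    by (rule summable_inverse_shift_power) (use x N in auto)
  have q: "summable q" unfolding q_def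
    by (intro summable_divide summable_inverse_shift_power) (use y in auto)
  have p0: "p n \<ge> 0" and q0: "q n \<ge> 0" for n unfolding p_def q_def using x y d by auto
  have D: "norm ((of_nat m + of_real y) ^ 2 + c ^ 2 * (of_nat n + of_real x) ^ 2 :: complex)
      \<ge> d * (real m + y) ^ 2" for n m
    using norm_sum_squares_ge[of c "real m + y" "real n + x"] c y unfolding d_def by simp
  have bound: "norm (K (n, m)) \<le> p n * q m" for n m
  proof -
    have pos: "d * (real m + y) ^ 2 > 0" "(real n + x) ^ (2 * N) > 0" using d x y by auto
    have "norm (K (n, m)) = p n *
        (1 / norm ((of_nat m + of_real y) ^ 2 + c ^ 2 * (of_nat n + of_real x) ^ 2 :: complex))"
      unfolding K_def p_def by (simp add: norm_divide norm_mult norm_power norm_of_nat_plus_of_real[OF x])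
    also have "\<dots> \<le> p n * (1 / (d * (real m + y) ^ 2))"
      using D[where n = n and m = m] pos by (intro mult_left_mono frac_le p0) auto
    finally show ?thesis by (simp add: q_def mult.commute)
  qed
  show "K summable_on UNIV"
    by (rule iterated_suminf_eq_infsum(1)[OF p q p0 q0 bound])
  have inner: "summable (\<lambda>m. K (n, m))" for n
    by (rule summable_comparison_test'[OF summable_mult[OF q, of "p n"]]) (use bound in auto)
  \<comment> \<open>Needed to pull the constant \<open>2 * \<i> * c\<close> out of the outer
    series.\<close>
  have outer: "summable (\<lambda>n. \<Sum>m. K (n, m))"
  proof (rule summable_comparison_test'[OF summable_mult2[OF p, of "suminf q"]])
    fix n
    have s: "summable (\<lambda>m. norm (K (n, m)))"
      by (rule summable_comparison_test'[OF summable_mult[OF q, of "p n"]]) (use bound in auto)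
    have "norm (\<Sum>m. K (n, m)) \<le> (\<Sum>m. norm (K (n, m)))" by (rule summable_norm[OF s])
    also have "\<dots> \<le> (\<Sum>m. p n * q m)"
      by (intro suminf_le bound s summable_mult q)
    finally show "norm (\<Sum>m. K (n, m)) \<le> p n * suminf q" by (simp add: suminf_mult[OF q])
  qed
  have "(-1) ^ n / (of_nat n + of_real x) ^ (2 * N + 1) *
            (alt_digamma (of_real y + \<i> * c * (of_nat n + of_real x)) -
             alt_digamma (of_real y - \<i> * c * (of_nat n + of_real x))) =
        2 * \<i> * c * (\<Sum>m. K (n, m))" for n
  proof -
    define a :: complex where "a = of_nat n + of_real x"
    have a: "a \<noteq> 0" using x norm_of_nat_plus_of_real[OF x, of n] unfolding a_def by force
    \<comment> \<open>Since \<open>Re c\<close> is positive, both digamma arguments are nonreal, as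
      the difference formula requires.\<close>
    have "Im (\<i> * c * a) = Re c * (real n + x)" by (simp add: a_def)
    then have im: "Im (\<i> * c * a) \<noteq> 0" using c x by simp
    have K: "K (n, m) = (-1) ^ n / a ^ (2 * N) *
        ((-1) ^ m / ((of_nat m + of_real y)\<^sup>2 - (\<i> * c * a)\<^sup>2))" for m
      unfolding K_def a_def by (simp add: power_mult_distrib)
    \<comment> \<open>Recovered from the summability of the rows of \<open>K\<close> by cancelling
      the nonzero factor \<open>(-1) ^ n / a ^ (2 * N)\<close>.\<close>
    have "summable (\<lambda>m. (-1) ^ m / ((of_nat m + of_real y)\<^sup>2 - (\<i> * c * a)\<^sup>2))"
      using inner[of n] a unfolding K by (subst (asm) summable_cmult_iff) auto
    then have "(\<Sum>m. K (n, m)) = (-1) ^ n / a ^ (2 * N) *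
        (\<Sum>m. (-1) ^ m / ((of_nat m + of_real y)\<^sup>2 - (\<i> * c * a)\<^sup>2))"
      unfolding K by (rule suminf_mult)
    moreover have "alt_digamma (of_real y + \<i> * c * a) - alt_digamma (of_real y - \<i> * c * a) =
        2 * (\<i> * c * a) * (\<Sum>m. (-1) ^ m / ((of_nat m + of_real y)\<^sup>2 - (\<i> * c * a)\<^sup>2))"
      by (rule alt_digamma_diff) (use im in auto)
    ultimately show ?thesis
      unfolding a_def[symmetric] using a by simp
  qed
  then show "(\<Sum>n. (-1) ^ n / (of_nat n + of_real x) ^ (2 * N + 1) *
            (alt_digamma (of_real y + \<i> * c * (of_nat n + of_real x)) -
             alt_digamma (of_real y - \<i> * c * (of_nat n + of_real x)))) =
         2 * \<i> * c * infsum K UNIV"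
    by (simp only: suminf_mult[OF outer] iterated_suminf_eq_infsum(2)[OF p q p0 q0 bound])
qed

section \<open>The finite geometric sum behind the termwise identity\<close>

lemma geometric_sum_two_variables:
  fixes u v :: "'a :: comm_ring_1"
  shows "(u - v) * (\<Sum>k=1..N. v ^ (N + 1 - k) * u ^ k) = u * v * (u ^ N - v ^ N)"
proof (induction N)
  case (Suc N)
  \<comment> \<open>Raising \<open>N\<close> by one multiplies every old term by \<open>v\<close>;
    the new term k = N + 1 carries a single factor \<open>v\<close>.\<close>
  have "(\<Sum>k=1..Suc N. v ^ (Suc N + 1 - k) * u ^ k) =
      v * (\<Sum>k=1..N. v ^ (N + 1 - k) * u ^ k) + v * u ^ Suc N"
    by (simp add: sum_distrib_left Suc_diff_le mult_ac)
  then have "(u - v) * (\<Sum>k=1..Suc N. v ^ (Suc N + 1 - k) * u ^ k) =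
      v * ((u - v) * (\<Sum>k=1..N. v ^ (N + 1 - k) * u ^ k)) + (u - v) * v * u ^ Suc N"
    by (simp add: algebra_simps)
  also have "\<dots> = u * v * (u ^ Suc N - v ^ Suc N)"
    unfolding Suc by (simp add: algebra_simps)
  finally show ?case .
qed simp

text \<open>With D = \<beta> b^2 + \<alpha> a^2, both u - v and u v have denominator a^2 b^2. It
  cancels in the geometric sum formula, and dividing by D leaves one term in u^N and one in v^N, one
  for each digamma series.\<close>

lemma termwise_identity:
  fixes \<alpha> \<beta> a b :: "'a :: field"
  assumes a: "a \<noteq> 0" and b: "b \<noteq> 0" and D: "\<beta> * b ^ 2 + \<alpha> * a ^ 2 \<noteq> 0"
  shows "(\<Sum>k=1..N. (- \<alpha>) ^ (N + 1 - k) * \<beta> ^ k / (a ^ (2 * k) * b ^ (2 * (N + 1 - k)))) =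
     - \<alpha> * \<beta> ^ (N + 1) / (a ^ (2 * N) * (\<beta> * b ^ 2 + \<alpha> * a ^ 2)) -
     \<beta> * (- \<alpha>) ^ (N + 1) / (b ^ (2 * N) * (\<beta> * b ^ 2 + \<alpha> * a ^ 2))"
proof -
  define u v S where "u = \<beta> / a ^ 2" and "v = - \<alpha> / b ^ 2"
    and "S = (\<Sum>k=1..N. v ^ (N + 1 - k) * u ^ k)"
  have S: "(\<Sum>k=1..N. (- \<alpha>) ^ (N + 1 - k) * \<beta> ^ k / (a ^ (2 * k) * b ^ (2 * (N + 1 - k)))) = S"
    unfolding S_def u_def v_def power_divide power_mult times_divide_times_eq
    by (intro sum.cong refl) (simp only: mult.commute[of "(a\<^sup>2) ^ _"])
  have uv: "u - v = (\<beta> * b ^ 2 + \<alpha> * a ^ 2) / (a ^ 2 * b ^ 2)"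
    using a b unfolding u_def v_def by (simp add: field_simps)
  have uv': "u * v = - \<alpha> * \<beta> / (a ^ 2 * b ^ 2)" unfolding u_def v_def by simp
  have "(u - v) * S = u * v * (u ^ N - v ^ N)"
    unfolding S_def by (rule geometric_sum_two_variables)
  then have "(\<beta> * b ^ 2 + \<alpha> * a ^ 2) * S = - \<alpha> * \<beta> * (u ^ N - v ^ N)"
    unfolding uv uv' times_divide_eq_left divide_cancel_right using a b by simp
  then have "S = - \<alpha> * \<beta> * (u ^ N - v ^ N) / (\<beta> * b ^ 2 + \<alpha> * a ^ 2)"
    using D by (metis nonzero_mult_div_cancel_left)
  also have "u ^ N = \<beta> ^ N / a ^ (2 * N)" unfolding u_def by (simp add: power_divide power_mult)
  also have "v ^ N = (- \<alpha>) ^ N / b ^ (2 * N)" unfolding v_def by (simp only: power_divide power_mult)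
  finally show ?thesis
    unfolding S by (simp add: right_diff_distrib diff_divide_distrib mult_ac)
qed

section \<open>Summation of the termwise identity over all pairs\<close>

theorem theorem1p15:
  fixes \<alpha> \<beta> :: complex and x y :: real and N :: nat
  assumes "Re \<alpha> > 0" and "Re \<beta> > 0" and "\<alpha> * \<beta> = 4 * of_real pi ^ 2"
    and "x > 0" and "y > 0" and "N > 0"
  shows
    "(\<Sum>k=1..N. (- \<alpha>) ^ (N + 1 - k) * \<beta> ^ k *
        alt_hurwitz_zeta (of_nat (2 * k)) (of_real x) *
        alt_hurwitz_zeta (of_nat (2 * (N + 1 - k))) (of_real y)) =
     \<beta> ^ (N + 1) * (1 / 2) * \<i> * csqrt (\<alpha> / \<beta>) *
       (\<Sum>n. (-1) ^ n / (of_nat n + of_real x) ^ (2 * N + 1) *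
          (alt_digamma (of_real y + \<i> * csqrt (\<alpha> / \<beta>) * (of_nat n + of_real x)) -
           alt_digamma (of_real y - \<i> * csqrt (\<alpha> / \<beta>) * (of_nat n + of_real x)))) +
     (- \<alpha>) ^ (N + 1) * (1 / 2) * \<i> * csqrt (\<beta> / \<alpha>) *
       (\<Sum>n. (-1) ^ n / (of_nat n + of_real y) ^ (2 * N + 1) *
          (alt_digamma (of_real x + \<i> * csqrt (\<beta> / \<alpha>) * (of_nat n + of_real y)) -
           alt_digamma (of_real x - \<i> * csqrt (\<beta> / \<alpha>) * (of_nat n + of_real y))))"
proof -
  define c where "c = csqrt (\<alpha> / \<beta>)"
  define c' where "c' = csqrt (\<beta> / \<alpha>)"
  have nz: "\<alpha> \<noteq> 0" "\<beta> \<noteq> 0" using assms by auto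
  \<comment> \<open>The relation \<alpha>\<beta> = 4 pi^2 supplies explicit square roots. Their
    positive real parts identify them with the principal ones, which yields \<open>Re c > 0\<close>
    and \<open>Re c' > 0\<close>.\<close>
  have sq: "(\<alpha> / (2 * of_real pi)) ^ 2 = \<alpha> / \<beta>" "(\<beta> / (2 * of_real pi)) ^ 2 = \<beta> / \<alpha>"
    using nz assms(3) by (auto simp: field_simps power2_eq_square)
  have "c = \<alpha> / of_real (2 * pi)" "c' = \<beta> / of_real (2 * pi)"
    unfolding c_def c'_def using assms(1,2) sq by (auto intro!: csqrt_unique simp: Re_divide_of_real)
  then have c: "Re c > 0" "Re c' > 0" using assms(1,2) by (auto simp: Re_divide_of_real)
  have c2: "c ^ 2 = \<alpha> / \<beta>" "c' ^ 2 = \<beta> / \<alpha>" unfolding c_def c'_def by auto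

  define A B where "A = (\<lambda>n. of_nat n + of_real x :: complex)"
    and "B = (\<lambda>m. of_nat m + of_real y :: complex)"
  have norms: "norm (A n) = real n + x" "norm (B n) = real n + y" for n
    unfolding A_def B_def using assms by (simp_all add: norm_of_nat_plus_of_real)
  have AB: "A n \<noteq> 0" "B n \<noteq> 0" for n
    using norms[of n] assms by auto
  define f where "f = (\<lambda>k n. (-1) ^ n / A n ^ (2 * k))"
  define g where "g = (\<lambda>k m. (-1) ^ m / B m ^ (2 * k))"
  have f: "summable (\<lambda>n. norm (f k n))" and g: "summable (\<lambda>n. norm (g k n))" if "k > 0" for k
    unfolding f_def g_def norm_divide norm_power norms using assms that
    by (auto intro!: summable_inverse_shift_power)

  define K where "K = (\<lambda>(n, m). (-1) ^ n * (-1) ^ m / (A n ^ (2 * N) * (B m ^ 2 + c ^ 2 * A n ^ 2)))"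
  define L where "L = (\<lambda>(m, n). (-1) ^ m * (-1) ^ n / (B m ^ (2 * N) * (A n ^ 2 + c' ^ 2 * B m ^ 2)))"
  have K: "K summable_on UNIV" and K': "(\<Sum>n. (-1) ^ n / A n ^ (2 * N + 1) *
      (alt_digamma (of_real y + \<i> * c * A n) - alt_digamma (of_real y - \<i> * c * A n))) =
      2 * \<i> * c * infsum K UNIV"
    using alt_digamma_series[OF c(1) assms(4,5,6)] unfolding K_def A_def B_def by auto
  have L: "L summable_on UNIV" and L': "(\<Sum>n. (-1) ^ n / B n ^ (2 * N + 1) *
      (alt_digamma (of_real x + \<i> * c' * B n) - alt_digamma (of_real x - \<i> * c' * B n))) =
      2 * \<i> * c' * infsum L UNIV"
    using alt_digamma_series[OF c(2) assms(5,4,6)] unfolding L_def A_def B_def by auto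
  \<comment> \<open>\<open>L\<close> takes the \<open>y\<close> index first; the swap aligns it with
    \<open>K\<close> and preserves the unordered sum.\<close>
  define L2 where "L2 = (\<lambda>p. L (prod.swap p))"
  have L2: "L2 summable_on UNIV" "infsum L2 UNIV = infsum L UNIV"
    unfolding L2_def using L
    by (simp_all add: summable_on_reindex_bij_betw[OF bij_swap] infsum_reindex_bij_betw[OF bij_swap])

  \<comment> \<open>As c^2 = \<alpha>/\<beta>, this is \<beta> times the sum of squares already
    bounded away from zero.\<close>
  have D: "\<beta> * B m ^ 2 + \<alpha> * A n ^ 2 \<noteq> 0" for n m
  proof -
    have "c \<noteq> 0" using c by auto
    have "0 < (Re c / norm c) ^ 2 * (real m + y) ^ 2"
      using c(1) \<open>c \<noteq> 0\<close> assms(5) by simp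
    also have "\<dots> \<le> norm (B m ^ 2 + c ^ 2 * A n ^ 2)"
      using norm_sum_squares_ge[OF c(1), of "real m + y" "real n + x"] assms(5)
      by (simp add: A_def B_def)
    finally have "B m ^ 2 + c ^ 2 * A n ^ 2 \<noteq> 0" by auto
    then show ?thesis using nz unfolding c2 by (simp add: field_simps)
  qed
  \<comment> \<open>Over the common denominator \<open>?D\<close>, \<open>K\<close> acquires a
    factor \<beta> and \<open>L2\<close> a factor \<alpha>; the coefficients -c^2 and -c'^2 turn
    these into the -\<alpha> and -\<beta> of the termwise identity.\<close>
  have termwise: "(\<Sum>k=1..N. (- \<alpha>) ^ (N + 1 - k) * \<beta> ^ k * (f k n * g (N + 1 - k) m)) =
      \<beta> ^ (N + 1) * (- (c ^ 2)) * K (n, m) + (- \<alpha>) ^ (N + 1) * (- (c' ^ 2)) * L2 (n, m)" for n m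
  proof -
    let ?D = "\<beta> * B m ^ 2 + \<alpha> * A n ^ 2"
    have "(\<Sum>k=1..N. (- \<alpha>) ^ (N + 1 - k) * \<beta> ^ k * (f k n * g (N + 1 - k) m)) =
        (-1) ^ n * (-1) ^ m *
        (\<Sum>k=1..N. (- \<alpha>) ^ (N + 1 - k) * \<beta> ^ k / (A n ^ (2 * k) * B m ^ (2 * (N + 1 - k))))"
      unfolding sum_distrib_left f_def g_def by (intro sum.cong) auto
    also have "\<dots> = (-1) ^ n * (-1) ^ m * (- \<alpha> * \<beta> ^ (N + 1) / (A n ^ (2 * N) * ?D) -
        \<beta> * (- \<alpha>) ^ (N + 1) / (B m ^ (2 * N) * ?D))"
      by (simp only: termwise_identity[OF AB(1) AB(2) D])
    also have "K (n, m) = (-1) ^ n * (-1) ^ m * \<beta> / (A n ^ (2 * N) * ?D)"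
    proof -
      have "B m ^ 2 + c ^ 2 * A n ^ 2 = ?D / \<beta>" using nz unfolding c2 by (simp add: field_simps)
      then show ?thesis by (simp add: K_def)
    qed
    moreover have "L2 (n, m) = (-1) ^ n * (-1) ^ m * \<alpha> / (B m ^ (2 * N) * ?D)"
    proof -
      have "A n ^ 2 + c' ^ 2 * B m ^ 2 = ?D / \<alpha>" using nz unfolding c2 by (simp add: field_simps)
      then show ?thesis by (simp add: L2_def L_def)
    qed
    ultimately show ?thesis
      unfolding c2 using nz by (simp add: right_diff_distrib mult_ac)
  qed

  \<comment> \<open>For \<open>k\<close> in \<open>{1..N}\<close> both \<open>k\<close> and
    \<open>N + 1 - k\<close> are positive, so both zeta series converge absolutely.\<close>
  have prods: "(\<lambda>(n, m). f k n * g (N + 1 - k) m) summable_on UNIV"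
    "suminf (f k) * suminf (g (N + 1 - k)) = (\<Sum>\<^sub>\<infinity>(n, m). f k n * g (N + 1 - k) m)"
    if "k \<in> {1..N}" for k
    using that by (intro suminf_mult_suminf_eq_infsum f g; simp)+
  have zf: "alt_hurwitz_zeta (of_nat (2 * k)) (of_real x) = suminf (f k)"
    and zg: "alt_hurwitz_zeta (of_nat (2 * k)) (of_real y) = suminf (g k)" if "k > 0" for k
    using that by (simp_all only: alt_hurwitz_zeta_of_nat f_def g_def A_def B_def)
  have "(\<Sum>k=1..N. (- \<alpha>) ^ (N + 1 - k) * \<beta> ^ k *
        alt_hurwitz_zeta (of_nat (2 * k)) (of_real x) *
        alt_hurwitz_zeta (of_nat (2 * (N + 1 - k))) (of_real y)) =
      (\<Sum>k=1..N. (- \<alpha>) ^ (N + 1 - k) * \<beta> ^ k * (\<Sum>\<^sub>\<infinity>(n, m). f k n * g (N + 1 - k) m))"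
    by (intro sum.cong refl) (subst prods(2)[symmetric], simp_all add: zf zg del: of_nat_mult)
  also have "\<dots> = (\<Sum>\<^sub>\<infinity>p. \<Sum>k=1..N. (- \<alpha>) ^ (N + 1 - k) * \<beta> ^ k *
        (case p of (n, m) \<Rightarrow> f k n * g (N + 1 - k) m))"
    by (rule sym, rule infsumI)
       (use prods(1) in \<open>auto intro!: has_sum_sum has_sum_cmult_right has_sum_infsum\<close>)
  also have "\<dots> = (\<Sum>\<^sub>\<infinity>p. \<beta> ^ (N + 1) * (- (c ^ 2)) * K p + (- \<alpha>) ^ (N + 1) * (- (c' ^ 2)) * L2 p)"
    by (intro infsum_cong) (auto simp only: split_paired_all prod.case termwise)
  also have "\<dots> = \<beta> ^ (N + 1) * (- (c ^ 2)) * infsum K UNIV + (- \<alpha>) ^ (N + 1) * (- (c' ^ 2)) * infsum L UNIV"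
    unfolding L2(2)[symmetric] using K L2(1)
    by (intro infsumI has_sum_add has_sum_cmult_right has_sum_infsum)
  also have "\<dots> = \<beta> ^ (N + 1) * (1 / 2) * \<i> * c * (2 * \<i> * c * infsum K UNIV) +
      (- \<alpha>) ^ (N + 1) * (1 / 2) * \<i> * c' * (2 * \<i> * c' * infsum L UNIV)"
  \<comment> \<open>One factor \<open>\<i> * c\<close> is the coefficient in the claim, the other
    comes from the digamma difference; their product is -c^2, and 1/2 cancels 2. The same holds for
    \<open>c'\<close>.\<close>
  proof -
    have "(1 / 2) * \<i> * d * (2 * \<i> * d * z) = (\<i> * \<i>) * (d ^ 2 * z)" for d z
      by (simp add: power2_eq_square mult_ac del: complex_i_mult_minus i_squared)
    then have "w * (1 / 2) * \<i> * d * (2 * \<i> * d * z) = w * (- (d ^ 2)) * z" for w d z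
      by (simp add: mult.assoc)
    then show ?thesis by (simp only:)
  qed
  finally show ?thesis
    unfolding K'[symmetric] L'[symmetric] unfolding A_def B_def c_def c'_def .
qed

end
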